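(* Let $(X,s)$ be a real metrizable topological vector space and let $d$ be a fixed metric on $X$ compatible with $s$. Let $f,g:X\to\overline{\mathbb R}$. (a) For every $x\in X$, $\partial_F f(x)\subset\eth_d f(x)$. If, in addition, $X$ is normed and $f$ is convex, then $\eth f(x)=\partial_F f(x)$ for every $x\in X$. (b) If $x$ is a local minimum point of $f$, then $0\in\eth_d f(x)$. (c) If $\eth_d f(x)\neq\emptyset$, then $f$ is lower semicontinuous at $x$. (d) If $g=f$ near $x$ (on a neighborhood of $x$), then $\eth_d g(x)=\eth_d f(x)$. (e) If, in addition, $X$ is normed and $\eth$ denotes the norm-metric core, then, for every $x\in X$, $\eth f(x)$ is norm closed in $X^*$. (f) If $d$ is translation invariant and $g(x)=f(x+x_0)$ (for all $x\in X$, with $x_0\in X$ fixed), then $\eth_d g(0)=\eth_d f(x_0)$. (g) For every $\ell^*\in X^*$, every $\lambda>0$, and every $\bar x\in X$, $$\eth_d(\lambda f+\ell^* )(\bar x)=\lambda\,\eth_d f(\bar x)+\ell^*,$$ where $\ell^*$ is identified with the linear function $u\mapsto\langle u,\ell^*\rangle$.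
   Context: $\overline{\mathbb R}=[-\infty,+\infty]$; $X^*$ is the topological dual of $X$ and $\langle x,x^*\rangle:=x^*(x)$. A metric is compatible with $s$ if it generates the linear topology $s$. $\overline B_d(x;r):=\{y\in X\mid d(x,y)\le r\}$. Core subdifferential: for $f:X\to\overline{\mathbb R}$ and $x_0\in X$, a functional $x_0^*\in X^*$ belongs to $\eth_d f(x_0)$ if $f(x_0)\in\mathbb R$ and there is a family $(\delta_\varepsilon)_{\varepsilon>0}\subset(0,+\infty)$ with $\limsup_{\varepsilon\downarrow0}\delta_\varepsilon/\varepsilon=+\infty$ such that $f(x_0)+\langle x-x_0,x_0^*\rangle\le f(x)+\varepsilon$ for every $\varepsilon>0$ and every $x\in\overline B_d(x_0;\delta_\varepsilon)$. If $f(x_0)\notin\mathbb R$, then $\eth_d f(x_0)=\emptyset$. When $X$ is normed, $\eth$ denotes $\eth_d$ for the norm metric $d(x,y)=\|x-y\|$. Fenchel subdifferential: $\partial_F f(x):=\{x^*\in X^*\mid f(x)+\langle u-x,x^*\rangle\le f(u)\text{ for all }u\in X\}$.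
   Formalization: The Fenchel subdifferential is taken to be empty where f(x) is not finite, and a local minimum point is required to have a finite value; without this (a) and (b) fail, e.g. for f identically +∞ or where f(x) = −∞. *)

theory Defs
  imports "HOL-Analysis.Analysis"
begin

definition compatible_metric :: "('a::topological_space \<Rightarrow> 'a \<Rightarrow> real) \<Rightarrow> bool" where
  "compatible_metric d \<longleftrightarrow> Metric_space UNIV d \<and> Metric_space.mtopology UNIV d = euclidean"

definition top_dual :: "('a::{real_vector, topological_space} \<Rightarrow> real) set" where
  "top_dual = {l. linear l \<and> continuous_on UNIV l}"

text \<open>The metric \<open>d\<close> enters only through its closed balls; the topology of the type enters only
  through the dual. For a normed space the norm-metric core is \<open>core_subdiff dist\<close>.\<close>

definition core_subdiff ::
  "('a::{real_vector, topological_space} \<Rightarrow> 'a \<Rightarrow> real) \<Rightarrow> ('a \<Rightarrow> ereal) \<Rightarrow> 'a \<Rightarrow> ('a \<Rightarrow> real) set" where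
  "core_subdiff d f x0 =
    {l \<in> top_dual. \<bar>f x0\<bar> \<noteq> \<infinity> \<and>
      (\<exists>\<delta> :: real \<Rightarrow> real.
        (\<forall>\<epsilon>>0. \<delta> \<epsilon> > 0) \<and>
        Limsup (at_right 0) (\<lambda>\<epsilon>. ereal (\<delta> \<epsilon> / \<epsilon>)) = \<infinity> \<and>
        (\<forall>\<epsilon>>0. \<forall>x. d x0 x \<le> \<delta> \<epsilon> \<longrightarrow> f x0 + ereal (l (x - x0)) \<le> f x + ereal \<epsilon>))}"

text \<open>As for the core, the Fenchel subdifferential is taken to be empty where \<open>f\<close> is not finite.
  Without this convention it would be the whole dual at \<open>x\<close> whenever \<open>f x = -\<infinity>\<close> (or \<open>f\<close> is
  identically \<open>\<infinity>\<close>), and could not be contained in the core.\<close>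

definition fenchel_subdiff ::
  "('a::{real_vector, topological_space} \<Rightarrow> ereal) \<Rightarrow> 'a \<Rightarrow> ('a \<Rightarrow> real) set" where
  "fenchel_subdiff f x =
    {l \<in> top_dual. \<bar>f x\<bar> \<noteq> \<infinity> \<and> (\<forall>u. f x + ereal (l (u - x)) \<le> f u)}"

text \<open>Convexity of an extended-real-valued function is convexity of its epigraph, so that no
  convention for \<open>\<infinity> - \<infinity>\<close> is involved.\<close>

definition convex_ereal_fun :: "('a::real_vector \<Rightarrow> ereal) \<Rightarrow> bool" where
  "convex_ereal_fun f \<longleftrightarrow> convex {(x, r :: real). f x \<le> ereal r}"

text \<open>A local minimum point is required to have a finite value: points with value \<open>-\<infinity>\<close>, and
  points near which \<open>f\<close> is identically \<open>\<infinity>\<close>, are not counted, since the core is empty there.\<close>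

definition local_minimum_point :: "('a::topological_space \<Rightarrow> ereal) \<Rightarrow> 'a \<Rightarrow> bool" where
  "local_minimum_point f x \<longleftrightarrow> \<bar>f x\<bar> \<noteq> \<infinity> \<and> (\<forall>\<^sub>F u in nhds x. f x \<le> f u)"

definition lsc_at :: "('a::topological_space \<Rightarrow> ereal) \<Rightarrow> 'a \<Rightarrow> bool" where
  "lsc_at f x \<longleftrightarrow> (\<forall>c<f x. \<forall>\<^sub>F u in nhds x. c < f u)"

end

theory Submission
  imports Defs
begin

text \<open>
  The family \<open>\<delta>\<close> in the definition of the core can be eliminated. Say that \<open>l\<close> supports \<open>f\<close> at \<open>x\<close> up to
  \<open>\<epsilon>\<close> on a ball if \<open>f x + l (u - x) \<le> f u + \<epsilon>\<close> for all \<open>u\<close> in it. Support survives shrinking the ball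
  and enlarging \<open>\<epsilon>\<close>, so only the best radius for each \<open>\<epsilon>\<close> matters: a continuous linear \<open>l\<close> lies in
  the core at a point \<open>x\<close> where \<open>f\<close> is finite exactly when for every \<open>M > 0\<close> there are arbitrarily
  small \<open>\<epsilon>\<close> such that \<open>l\<close> supports \<open>f\<close> up to \<open>\<epsilon>\<close> on the ball of radius \<open>M * \<epsilon>\<close> (lemma \<open>core_subdiff_iff\<close>). Since those balls shrink with \<open>\<epsilon>\<close>, everything
  is visibly local, and each claim becomes a short computation with \<open>M\<close> and \<open>\<epsilon>\<close>.

  \<^item> Such an \<open>l\<close> with \<open>f x + l (u - x) \<le> f u\<close> near \<open>x\<close> is in the core. This gives the Fenchel inclusion
    and the statement on local minima. In the other direction, support up to every \<open>\<epsilon>\<close> on some ball bounds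
    \<open>f\<close> from below near \<open>x\<close> by values close to \<open>f x\<close>, which is lower semicontinuity.
  \<^item> For convex \<open>f\<close> a failure of the Fenchel inequality at \<open>u\<close> by an amount \<open>c > 0\<close> propagates along
    the segment from \<open>x\<close> to \<open>u\<close>: at distance \<open>r\<close> from \<open>x\<close> the failure is at least \<open>c * r / norm (u - x)\<close>.
    With \<open>r = M * \<epsilon>\<close> and \<open>M\<close> large this exceeds the permitted error \<open>\<epsilon>\<close>.
  \<^item> A functional within \<open>1 / (2 * M)\<close> of \<open>l\<close> differs from it by at most \<open>\<epsilon>\<close> on the ball of radius
    \<open>2 * M * \<epsilon>\<close>. Doubling \<open>\<epsilon>\<close> absorbs this error, so the core is norm closed.
  \<^item> Scaling \<open>f\<close> by \<open>\<mu>\<close> scales \<open>\<epsilon>\<close> by \<open>\<mu>\<close>, and adding a linear functional to \<open>f\<close> and \<open>l\<close> alike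
    changes nothing; the opposite inclusion is the same statement for the inverse operation.
\<close>

section \<open>The core without families of radii\<close>

definition supports_up_to ::
  "('a::real_vector \<Rightarrow> 'a \<Rightarrow> real) \<Rightarrow> ('a \<Rightarrow> ereal) \<Rightarrow> 'a \<Rightarrow> ('a \<Rightarrow> real) \<Rightarrow> real \<Rightarrow> real \<Rightarrow> bool" where
  "supports_up_to d f x l r \<epsilon> \<longleftrightarrow>
    (\<forall>u. d x u \<le> r \<longrightarrow> f x + ereal (l (u - x)) \<le> f u + ereal \<epsilon>)"

lemma supports_up_to_mono:
  assumes "supports_up_to d f x l r \<epsilon>" "r' \<le> r" "\<epsilon> \<le> \<epsilon>'"
  shows "supports_up_to d f x l r' \<epsilon>'"
  unfolding supports_up_to_def
proof (intro allI impI)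
  fix u assume "d x u \<le> r'"
  then have "f x + ereal (l (u - x)) \<le> f u + ereal \<epsilon>"
    using assms unfolding supports_up_to_def by auto
  also have "\<dots> \<le> f u + ereal \<epsilon>'"
    using assms by (intro add_left_mono) simp
  finally show "f x + ereal (l (u - x)) \<le> f u + ereal \<epsilon>'" .
qed

lemma Limsup_eq_PInfty_iff:
  fixes h :: "real \<Rightarrow> real"
  shows "Limsup (at_right 0) (\<lambda>\<epsilon>. ereal (h \<epsilon>)) = \<infinity> \<longleftrightarrow>
    (\<forall>M>0. \<forall>\<eta>>0. \<exists>\<epsilon>. 0 < \<epsilon> \<and> \<epsilon> < \<eta> \<and> M < h \<epsilon>)" (is "?L \<longleftrightarrow> ?R")
proof
  assume L: ?L
  show ?R
  proof (rule ccontr)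
    assume "\<not> ?R"
    then obtain M \<eta> where "\<eta> > 0" "\<forall>\<epsilon>>0. \<epsilon> < \<eta> \<longrightarrow> h \<epsilon> \<le> M"
      by (meson not_less)
    then have "\<forall>\<^sub>F \<epsilon> in at_right 0. ereal (h \<epsilon>) \<le> ereal M"
      unfolding eventually_at_right_field by auto
    then have "Limsup (at_right 0) (\<lambda>\<epsilon>. ereal (h \<epsilon>)) \<le> ereal M"
      by (rule Limsup_bounded)
    with L show False by simp
  qed
next
  assume R: ?R
  show ?L
  proof (rule ccontr)
    assume "\<not> ?L"
    then have "Limsup (at_right 0) (\<lambda>\<epsilon>. ereal (h \<epsilon>)) < \<infinity>"
      by simp
    then obtain a where a: "Limsup (at_right 0) (\<lambda>\<epsilon>. ereal (h \<epsilon>)) < ereal a"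
      using ereal_dense2[of _ \<infinity>] by auto
    define M where "M = max a 1"
    have "Limsup (at_right 0) (\<lambda>\<epsilon>. ereal (h \<epsilon>)) < ereal M"
      using a by (rule less_le_trans) (simp add: M_def)
    then have "\<forall>\<^sub>F \<epsilon> in at_right 0. ereal (h \<epsilon>) < ereal M"
      by (rule Limsup_lessD)
    then obtain \<eta> where "\<eta> > 0" "\<forall>\<epsilon>>0. \<epsilon> < \<eta> \<longrightarrow> h \<epsilon> < M"
      unfolding eventually_at_right_field by auto
    moreover have "M > 0"
      by (simp add: M_def)
    ultimately show False
      using R by (meson less_asym)
  qed
qed

text \<open>From right to left, the radius taken for \<open>\<epsilon>\<close> is half the supremum of the admissible radii.
  Radii are capped at \<open>1\<close> to keep the supremum finite; the cap is harmless because the radii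
  \<open>M * \<epsilon>\<close> that matter tend to \<open>0\<close>. Admissible radii exist for every \<open>\<epsilon>\<close>, since one that is admissible
  for a smaller error is admissible for \<open>\<epsilon>\<close>.\<close>

lemma core_subdiff_iff:
  "l \<in> core_subdiff d f x \<longleftrightarrow>
    l \<in> top_dual \<and> \<bar>f x\<bar> \<noteq> \<infinity> \<and>
    (\<forall>M>0. \<forall>\<eta>>0. \<exists>\<epsilon>. 0 < \<epsilon> \<and> \<epsilon> < \<eta> \<and> supports_up_to d f x l (M * \<epsilon>) \<epsilon>)"
proof -
  have family_iff: "(\<exists>\<delta>. (\<forall>\<epsilon>>0. \<delta> \<epsilon> > 0) \<and> Limsup (at_right 0) (\<lambda>\<epsilon>. ereal (\<delta> \<epsilon> / \<epsilon>)) = \<infinity> \<and>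
          (\<forall>\<epsilon>>0. supports_up_to d f x l (\<delta> \<epsilon>) \<epsilon>)) \<longleftrightarrow>
        (\<forall>M>0. \<forall>\<eta>>0. \<exists>\<epsilon>. 0 < \<epsilon> \<and> \<epsilon> < \<eta> \<and> supports_up_to d f x l (M * \<epsilon>) \<epsilon>)"
    (is "?family \<longleftrightarrow> ?linear")
  proof
    assume ?family
    then obtain \<delta> where
      large: "\<forall>M>0. \<forall>\<eta>>0. \<exists>\<epsilon>. 0 < \<epsilon> \<and> \<epsilon> < \<eta> \<and> M < \<delta> \<epsilon> / \<epsilon>" and
      supp: "\<forall>\<epsilon>>0. supports_up_to d f x l (\<delta> \<epsilon>) \<epsilon>"
      unfolding Limsup_eq_PInfty_iff by blast
    show ?linear
    proof (intro allI impI)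
      fix M \<eta> :: real assume "M > 0" "\<eta> > 0"
      with large obtain \<epsilon> where \<epsilon>: "0 < \<epsilon>" "\<epsilon> < \<eta>" "M < \<delta> \<epsilon> / \<epsilon>"
        by blast
      then have "M * \<epsilon> \<le> \<delta> \<epsilon>"
        by (simp add: field_simps)
      with \<epsilon> supp show "\<exists>\<epsilon>. 0 < \<epsilon> \<and> \<epsilon> < \<eta> \<and> supports_up_to d f x l (M * \<epsilon>) \<epsilon>"
        by (meson order_refl supports_up_to_mono)
    qed
  next
    assume lin: ?linear
    define S where "S \<epsilon> = {r. 0 < r \<and> r \<le> 1 \<and> supports_up_to d f x l r \<epsilon>}" for \<epsilon>
    define \<delta> where "\<delta> \<epsilon> = Sup (S \<epsilon>) / 2" for \<epsilon>
    have bdd: "bdd_above (S \<epsilon>)" for \<epsilon>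
      unfolding S_def bdd_above_def by blast
    have nonempty: "S \<epsilon> \<noteq> {}" if \<epsilon>: "\<epsilon> > 0" for \<epsilon>
    proof -
      obtain \<epsilon>' where "0 < \<epsilon>'" "\<epsilon>' < \<epsilon>" "supports_up_to d f x l \<epsilon>' \<epsilon>'"
        using lin[rule_format, of 1 \<epsilon>] \<epsilon> by auto
      then have "min \<epsilon>' 1 \<in> S \<epsilon>"
        unfolding S_def by (auto elim: supports_up_to_mono)
      then show ?thesis by blast
    qed
    have pos: "Sup (S \<epsilon>) > 0" if \<epsilon>: "\<epsilon> > 0" for \<epsilon>
    proof -
      obtain r where "r \<in> S \<epsilon>"
        using nonempty[OF \<epsilon>] by blast
      then show ?thesis
        using cSup_upper[OF _ bdd, of r \<epsilon>] unfolding S_def by auto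
    qed
    have supp: "supports_up_to d f x l (\<delta> \<epsilon>) \<epsilon>" if \<epsilon>: "\<epsilon> > 0" for \<epsilon>
    proof -
      have "\<delta> \<epsilon> < Sup (S \<epsilon>)"
        using pos[OF \<epsilon>] unfolding \<delta>_def by simp
      then obtain r where "r \<in> S \<epsilon>" "\<delta> \<epsilon> < r"
        using less_cSup_iff[OF nonempty[OF \<epsilon>] bdd] by blast
      then show ?thesis
        unfolding S_def by (auto elim: supports_up_to_mono)
    qed
    have large: "\<exists>\<epsilon>. 0 < \<epsilon> \<and> \<epsilon> < \<eta> \<and> M < \<delta> \<epsilon> / \<epsilon>" if pos_M\<eta>: "M > 0" "\<eta> > 0" for M \<eta>
    proof -
      \<comment> \<open>Asking for the slope \<open>3 * M\<close> makes the inequality strict after halving.\<close>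
      obtain \<epsilon> where \<epsilon>: "0 < \<epsilon>" "\<epsilon> < min \<eta> (1 / (3 * M))" "supports_up_to d f x l (3 * M * \<epsilon>) \<epsilon>"
        using lin[rule_format, of "3 * M" "min \<eta> (1 / (3 * M))"] pos_M\<eta> by auto
      then have "3 * M * \<epsilon> \<in> S \<epsilon>"
        using \<epsilon> pos_M\<eta> unfolding S_def by (auto simp: field_simps)
      then have "3 * M * \<epsilon> \<le> Sup (S \<epsilon>)"
        by (rule cSup_upper[OF _ bdd])
      then have "M * \<epsilon> < \<delta> \<epsilon>"
        using mult_pos_pos[OF \<open>M > 0\<close> \<epsilon>(1)] unfolding \<delta>_def by linarith
      then show ?thesis
        using \<epsilon> by (auto simp: field_simps)
    qed
    show ?family
      using pos supp large unfolding Limsup_eq_PInfty_iff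
      by (intro exI[of _ \<delta>]) (auto simp: \<delta>_def)
  qed
  have "l \<in> core_subdiff d f x \<longleftrightarrow> l \<in> top_dual \<and> \<bar>f x\<bar> \<noteq> \<infinity> \<and> ?family"
    unfolding core_subdiff_def supports_up_to_def mem_Collect_eq by (rule refl)
  then show ?thesis
    unfolding family_iff .
qed

lemma core_subdiffD:
  assumes "l \<in> core_subdiff d f x"
  shows "l \<in> top_dual" "\<bar>f x\<bar> \<noteq> \<infinity>"
    and "M > 0 \<Longrightarrow> \<eta> > 0 \<Longrightarrow> \<exists>\<epsilon>. 0 < \<epsilon> \<and> \<epsilon> < \<eta> \<and> supports_up_to d f x l (M * \<epsilon>) \<epsilon>"
proof -
  note * = assms[unfolded core_subdiff_iff]
  show "l \<in> top_dual" "\<bar>f x\<bar> \<noteq> \<infinity>"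
    by (rule *[THEN conjunct1], rule *[THEN conjunct2, THEN conjunct1])
  show "\<exists>\<epsilon>. 0 < \<epsilon> \<and> \<epsilon> < \<eta> \<and> supports_up_to d f x l (M * \<epsilon>) \<epsilon>" if "M > 0" "\<eta> > 0"
    using *[THEN conjunct2, THEN conjunct2, rule_format, OF that] .
qed

section \<open>Closed balls of a compatible metric\<close>

lemma eventually_nhds_compatible_metric:
  assumes "compatible_metric d"
  shows "eventually P (nhds x) \<longleftrightarrow> (\<exists>r>0. \<forall>u. d x u \<le> r \<longrightarrow> P u)"
proof -
  interpret Metric_space UNIV d
    using assms by (simp add: compatible_metric_def)
  have op: "open U \<longleftrightarrow> (\<forall>x\<in>U. \<exists>r>0. mcball x r \<subseteq> U)" for U
    using assms openin_mtopology_mcball[of U] by (auto simp: compatible_metric_def)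
  have op_mball: "open (mball x r)" for r
    using assms openin_mball[of x r] by (simp add: compatible_metric_def)
  show ?thesis
  proof
    assume "eventually P (nhds x)"
    then obtain U where "open U" "x \<in> U" "\<forall>u\<in>U. P u"
      unfolding eventually_nhds by blast
    with op obtain r where "r > 0" "mcball x r \<subseteq> U"
      by blast
    with \<open>\<forall>u\<in>U. P u\<close> show "\<exists>r>0. \<forall>u. d x u \<le> r \<longrightarrow> P u"
      by (metis UNIV_I in_mcball subsetD)
  next
    assume "\<exists>r>0. \<forall>u. d x u \<le> r \<longrightarrow> P u"
    then obtain r where "r > 0" "\<forall>u. d x u \<le> r \<longrightarrow> P u"
      by blast
    then show "eventually P (nhds x)"
      unfolding eventually_nhds using op_mball[of r]
      by (intro exI[of _ "mball x r"]) auto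
  qed
qed

section \<open>Local support, semicontinuity and locality\<close>

lemma core_subdiff_if_local_support:
  assumes d: "compatible_metric d"
    and l: "l \<in> top_dual" and fin: "\<bar>f x\<bar> \<noteq> \<infinity>"
    and near: "\<forall>\<^sub>F u in nhds x. f x + ereal (l (u - x)) \<le> f u"
  shows "l \<in> core_subdiff d f x"
  unfolding core_subdiff_iff
proof (intro conjI allI impI l fin)
  fix M \<eta> :: real assume "M > 0" "\<eta> > 0"
  obtain r where r: "r > 0" "\<And>u. d x u \<le> r \<Longrightarrow> f x + ereal (l (u - x)) \<le> f u"
    using near unfolding eventually_nhds_compatible_metric[OF d] by blast
  define \<epsilon> where "\<epsilon> = min (\<eta> / 2) (r / M)"
  have \<epsilon>: "0 < \<epsilon>" "\<epsilon> < \<eta>" "M * \<epsilon> \<le> r"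
    using \<open>M > 0\<close> \<open>\<eta> > 0\<close> \<open>r > 0\<close> unfolding \<epsilon>_def by (auto simp: min_def field_simps)
  have "supports_up_to d f x l r 0"
    using r unfolding supports_up_to_def by (simp add: zero_ereal_def[symmetric])
  with \<epsilon> show "\<exists>\<epsilon>. 0 < \<epsilon> \<and> \<epsilon> < \<eta> \<and> supports_up_to d f x l (M * \<epsilon>) \<epsilon>"
    by (intro exI[of _ \<epsilon>]) (auto elim: supports_up_to_mono)
qed

lemma fenchel_subdiff_subset_core:
  assumes "compatible_metric d"
  shows "fenchel_subdiff f x \<subseteq> core_subdiff d f x"
  using core_subdiff_if_local_support[OF assms, of _ f x] unfolding fenchel_subdiff_def by auto

lemma zero_in_core_of_local_minimum:
  assumes "compatible_metric d" "local_minimum_point f x"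
  shows "(\<lambda>_. 0) \<in> core_subdiff d f x"
proof (rule core_subdiff_if_local_support[OF assms(1)])
  show "(\<lambda>_. 0) \<in> top_dual"
    unfolding top_dual_def by (auto intro: module_hom_zero)
qed (use assms(2) in \<open>auto simp: local_minimum_point_def zero_ereal_def[symmetric]\<close>)

lemma eventually_top_dual_diff_less:
  fixes l :: "'a::{real_vector, topological_ab_group_add} \<Rightarrow> real"
  assumes "l \<in> top_dual" "c > 0"
  shows "\<forall>\<^sub>F u in nhds x. - c < l (u - x)"
proof -
  have lin: "linear l" and cont: "continuous_on UNIV l"
    using assms unfolding top_dual_def by auto
  have "open (l -` {l x - c<..})"
    using cont by (rule open_vimage[rotated]) simp
  then have "\<forall>\<^sub>F u in nhds x. u \<in> l -` {l x - c<..}"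
    using assms by (intro eventually_nhds_in_open) auto
  then show ?thesis
    by eventually_elim (auto simp: linear_diff[OF lin])
qed

text \<open>Below \<open>f x\<close> there is room for two errors: the one admitted by the support, and the drop of
  \<open>l (u - x)\<close> below \<open>0\<close>, which is small near \<open>x\<close> by continuity.\<close>

lemma lsc_at_if_core_nonempty:
  fixes f :: "'a::{real_vector, topological_ab_group_add} \<Rightarrow> ereal"
  assumes d: "compatible_metric d" and "core_subdiff d f x \<noteq> {}"
  shows "lsc_at f x"
  unfolding lsc_at_def
proof (intro allI impI)
  fix c assume c: "c < f x"
  obtain l where l: "l \<in> core_subdiff d f x"
    using assms by blast
  obtain a where a: "f x = ereal a"
    using core_subdiffD(2)[OF l] by auto
  then obtain b where b: "c < ereal b" "b < a"
    using c ereal_dense2[of c "f x"] by auto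
  define \<eta> where "\<eta> = (a - b) / 2"
  have "\<eta> > 0"
    using b unfolding \<eta>_def by simp
  obtain \<epsilon> where \<epsilon>: "0 < \<epsilon>" "\<epsilon> < \<eta>" "supports_up_to d f x l \<epsilon> \<epsilon>"
    using core_subdiffD(3)[OF l, of 1 \<eta>] \<open>\<eta> > 0\<close> by auto
  have "\<forall>\<^sub>F u in nhds x. d x u \<le> \<epsilon>"
    unfolding eventually_nhds_compatible_metric[OF d] using \<epsilon> by blast
  moreover have "\<forall>\<^sub>F u in nhds x. - \<eta> < l (u - x)"
    using core_subdiffD(1)[OF l] \<open>\<eta> > 0\<close> by (rule eventually_top_dual_diff_less)
  ultimately show "\<forall>\<^sub>F u in nhds x. c < f u"
  proof eventually_elim
    case (elim u)
    then have "ereal (a + l (u - x)) \<le> f u + ereal \<epsilon>"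
      using \<epsilon>(3) a unfolding supports_up_to_def by auto
    then have "ereal b < f u"
      using elim(2) \<epsilon>(2) unfolding \<eta>_def by (cases "f u") (auto simp: field_simps)
    then show ?case
      using b(1) by simp
  qed
qed

lemma core_subdiff_subset_if_eventually_eq:
  assumes d: "compatible_metric d" and eq: "\<forall>\<^sub>F u in nhds x. g u = f u"
  shows "core_subdiff d f x \<subseteq> core_subdiff d g x"
proof
  fix l assume l: "l \<in> core_subdiff d f x"
  have gx: "g x = f x"
    using eq by (rule eventually_nhds_x_imp_x)
  obtain r where r: "r > 0" "\<And>u. d x u \<le> r \<Longrightarrow> g u = f u"
    using eq unfolding eventually_nhds_compatible_metric[OF d] by blast
  show "l \<in> core_subdiff d g x"
    unfolding core_subdiff_iff
  proof (intro conjI allI impI)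
    fix M \<eta> :: real assume "M > 0" "\<eta> > 0"
    then obtain \<epsilon> where \<epsilon>: "0 < \<epsilon>" "\<epsilon> < min \<eta> (r / M)" "supports_up_to d f x l (M * \<epsilon>) \<epsilon>"
      using core_subdiffD(3)[OF l, of M "min \<eta> (r / M)"] r by auto
    then have "M * \<epsilon> \<le> r"
      using \<open>M > 0\<close> by (simp add: field_simps)
    then have "supports_up_to d g x l (M * \<epsilon>) \<epsilon>"
      using \<epsilon>(3) r(2) gx unfolding supports_up_to_def by auto
    then show "\<exists>\<epsilon>. 0 < \<epsilon> \<and> \<epsilon> < \<eta> \<and> supports_up_to d g x l (M * \<epsilon>) \<epsilon>"
      using \<epsilon> by auto
  qed (use core_subdiffD(1,2)[OF l] gx in auto)
qed

lemma core_subdiff_cong_nhds: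
  assumes "compatible_metric d" "\<forall>\<^sub>F u in nhds x. g u = f u"
  shows "core_subdiff d g x = core_subdiff d f x"
proof (rule equalityI)
  have "\<forall>\<^sub>F u in nhds x. f u = g u"
    using assms(2) by eventually_elim (rule sym)
  with assms(1) show "core_subdiff d g x \<subseteq> core_subdiff d f x"
    by (rule core_subdiff_subset_if_eventually_eq)
  show "core_subdiff d f x \<subseteq> core_subdiff d g x"
    using assms by (rule core_subdiff_subset_if_eventually_eq)
qed

section \<open>Normed spaces: convex functions and closedness\<close>

lemma convex_ereal_fun_segment:
  assumes "convex_ereal_fun f" "f x \<le> ereal a" "f u \<le> ereal b" "0 \<le> t" "t \<le> 1"
  shows "f (x + t *\<^sub>R (u - x)) \<le> ereal (a + t * (b - a))"
proof -
  have "(1 - t) *\<^sub>R (x, a) + t *\<^sub>R (u, b) \<in> {(x, r). f x \<le> ereal r}"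
    using assms unfolding convex_ereal_fun_def by (intro convexD) auto
  moreover have "(1 - t) *\<^sub>R x + t *\<^sub>R u = x + t *\<^sub>R (u - x)" "(1 - t) * a + t * b = a + t * (b - a)"
    by (simp_all add: algebra_simps)
  ultimately show ?thesis
    by simp
qed

text \<open>A violation of the Fenchel inequality at \<open>u\<close> by \<open>c > 0\<close> gives, at the fraction \<open>t\<close> of the way from
  \<open>x\<close> to \<open>u\<close>, a violation by \<open>t * c\<close>. The fraction \<open>t = 2 * \<epsilon> / c\<close> turns this into \<open>2 * \<epsilon>\<close>, and its
  point is at distance \<open>2 * norm (u - x) / c * \<epsilon>\<close> from \<open>x\<close>, a fixed multiple of \<open>\<epsilon>\<close>.\<close>

lemma core_subdiff_subset_fenchel_if_convex:
  fixes f :: "'b::real_normed_vector \<Rightarrow> ereal"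
  assumes conv: "convex_ereal_fun f"
  shows "core_subdiff dist f x \<subseteq> fenchel_subdiff f x"
proof
  fix l assume l: "l \<in> core_subdiff dist f x"
  have lin: "linear l"
    using core_subdiffD(1)[OF l] by (simp add: top_dual_def)
  obtain a where a: "f x = ereal a"
    using core_subdiffD(2)[OF l] by auto
  have bound: "a + l (u - x) \<le> b" if fu: "f u \<le> ereal b" for u b
  proof (rule ccontr)
    assume "\<not> ?thesis"
    then have c: "a + l (u - x) - b > 0" (is "?c > 0")
      by simp
    \<comment> \<open>Adding \<open>1\<close> keeps the slope positive in the case \<open>u = x\<close>.\<close>
    define M where "M = 2 * (norm (u - x) + 1) / ?c"
    have "M > 0"
      unfolding M_def using c by (intro divide_pos_pos mult_pos_pos) (auto intro: add_nonneg_pos)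
    then obtain \<epsilon> where \<epsilon>: "0 < \<epsilon>" "\<epsilon> < ?c / 2" "supports_up_to dist f x l (M * \<epsilon>) \<epsilon>"
      using core_subdiffD(3)[OF l, of M "?c / 2"] c by auto
    define t where "t = 2 * \<epsilon> / ?c"
    have t: "0 \<le> t" "t \<le> 1" "t * ?c = 2 * \<epsilon>"
      using \<epsilon> c unfolding t_def by (auto simp: field_simps)
    define v where "v = x + t *\<^sub>R (u - x)"
    have "dist x v = t * norm (u - x)"
      using t(1) unfolding v_def by (simp add: dist_norm)
    also have "\<dots> \<le> t * (norm (u - x) + 1)"
      using t(1) by (simp add: mult_left_mono)
    also have "\<dots> = M * \<epsilon>"
      unfolding t_def M_def by simp
    finally have "f x + ereal (l (v - x)) \<le> f v + ereal \<epsilon>"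
      using \<epsilon>(3) unfolding supports_up_to_def by blast
    moreover have "l (v - x) = t * l (u - x)"
      unfolding v_def by (simp add: linear_scale[OF lin])
    moreover have "f v \<le> ereal (a + t * (b - a))"
      using convex_ereal_fun_segment[OF conv _ fu t(1,2), of x a] a unfolding v_def by simp
    ultimately have "a + t * l (u - x) \<le> a + t * (b - a) + \<epsilon>"
      using a by (cases "f v") auto
    then have "t * ?c \<le> \<epsilon>"
      by (simp add: algebra_simps)
    then show False
      using t(3) \<epsilon>(1) by simp
  qed
  have "f x + ereal (l (u - x)) \<le> f u" for u
  proof (rule ereal_le_real)
    show "f x + ereal (l (u - x)) \<le> ereal b" if "f u \<le> ereal b" for b
      using bound[OF that] a by simp
  qed
  then show "l \<in> fenchel_subdiff f x"
    using core_subdiffD(1,2)[OF l] unfolding fenchel_subdiff_def by simp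
qed

lemma compatible_metric_dist: "compatible_metric (dist :: 'b::metric_space \<Rightarrow> 'b \<Rightarrow> real)"
  unfolding compatible_metric_def
  by (intro conjI Met_TC.Metric_space_axioms mtopology_is_euclidean)

lemma core_subdiff_eq_fenchel_if_convex:
  fixes f :: "'b::real_normed_vector \<Rightarrow> ereal"
  assumes "convex_ereal_fun f"
  shows "core_subdiff dist f x = fenchel_subdiff f x"
  using core_subdiff_subset_fenchel_if_convex[OF assms]
    fenchel_subdiff_subset_core[OF compatible_metric_dist] by (rule equalityI)

lemma blinfun_apply_in_top_dual: "blinfun_apply \<phi> \<in> top_dual"
  unfolding top_dual_def
  by (auto intro: bounded_linear.linear blinfun.bounded_linear_right continuous_intros)

text \<open>An approximating functional \<open>\<psi>\<close> with \<open>norm (\<phi> - \<psi>) \<le> 1 / (2 * M)\<close> is used with slope \<open>2 * M\<close> and error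
  \<open>\<epsilon>\<close>; its ball is then the ball of slope \<open>M\<close> for the error \<open>2 * \<epsilon>\<close>.\<close>

lemma closed_core_subdiff:
  fixes f :: "'b::real_normed_vector \<Rightarrow> ereal"
  shows "closed {\<phi> :: 'b \<Rightarrow>\<^sub>L real. blinfun_apply \<phi> \<in> core_subdiff dist f x}" (is "closed ?C")
proof -
  have "\<phi> \<in> ?C" if cl: "\<phi> \<in> closure ?C" for \<phi>
  proof -
    have approx: "\<exists>\<psi>\<in>?C. norm (\<phi> - \<psi>) < e" if "e > 0" for e
      using cl that unfolding closure_approachable by (metis dist_commute dist_norm)
    obtain \<psi>' where "blinfun_apply \<psi>' \<in> core_subdiff dist f x"
      using approx[OF zero_less_one] by blast
    then have fin: "\<bar>f x\<bar> \<noteq> \<infinity>"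
      by (rule core_subdiffD(2))
    have "blinfun_apply \<phi> \<in> core_subdiff dist f x"
      unfolding core_subdiff_iff
    proof (intro conjI allI impI blinfun_apply_in_top_dual fin)
      fix M \<eta> :: real assume pos: "M > 0" "\<eta> > 0"
      obtain \<psi> where \<psi>: "blinfun_apply \<psi> \<in> core_subdiff dist f x" "norm (\<phi> - \<psi>) < 1 / (2 * M)"
        using approx[of "1 / (2 * M)"] pos by auto
      obtain \<epsilon> where \<epsilon>: "0 < \<epsilon>" "\<epsilon> < \<eta> / 2"
        and supp: "supports_up_to dist f x \<psi> (2 * M * \<epsilon>) \<epsilon>"
        using core_subdiffD(3)[OF \<psi>(1), of "2 * M" "\<eta> / 2"] pos by auto
      have "supports_up_to dist f x \<phi> (M * (2 * \<epsilon>)) (2 * \<epsilon>)"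
        unfolding supports_up_to_def
      proof (intro allI impI)
        fix u assume u: "dist x u \<le> M * (2 * \<epsilon>)"
        have "\<phi> (u - x) - \<psi> (u - x) \<le> norm ((\<phi> - \<psi>) (u - x))"
          by (simp add: blinfun.diff_left)
        also have "\<dots> \<le> norm (\<phi> - \<psi>) * norm (u - x)"
          by (rule norm_blinfun)
        also have "\<dots> \<le> 1 / (2 * M) * (M * (2 * \<epsilon>))"
          using \<psi>(2) u pos by (intro mult_mono) (auto simp: dist_norm norm_minus_commute)
        also have "\<dots> = \<epsilon>"
          using pos by simp
        finally have le: "\<phi> (u - x) \<le> \<psi> (u - x) + \<epsilon>"
          by simp
        have "f x + ereal (\<psi> (u - x)) \<le> f u + ereal \<epsilon>"
          using supp u unfolding supports_up_to_def by (simp add: mult_ac)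
        with le fin show "f x + ereal (\<phi> (u - x)) \<le> f u + ereal (2 * \<epsilon>)"
          by (cases "f x"; cases "f u") auto
      qed
      then show "\<exists>\<epsilon>. 0 < \<epsilon> \<and> \<epsilon> < \<eta> \<and> supports_up_to dist f x \<phi> (M * \<epsilon>) \<epsilon>"
        using \<epsilon> by (intro exI[of _ "2 * \<epsilon>"]) auto
    qed
    then show ?thesis by simp
  qed
  then show ?thesis
    by (metis closure_subset_eq subsetI)
qed

section \<open>Translation, scaling and linear perturbation\<close>

lemma core_subdiff_translate:
  assumes inv: "\<And>x y z. d (x + z) (y + z) = d x y" and g: "\<And>x. g x = f (x + x0)"
  shows "core_subdiff d g 0 = core_subdiff d f x0"
proof -
  have "supports_up_to d g 0 l r \<epsilon> \<longleftrightarrow> supports_up_to d f x0 l r \<epsilon>" for l r \<epsilon>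
  proof -
    have "supports_up_to d f x0 l r \<epsilon> \<longleftrightarrow>
        (\<forall>u. d x0 (u + x0) \<le> r \<longrightarrow> f x0 + ereal (l u) \<le> f (u + x0) + ereal \<epsilon>)"
      unfolding supports_up_to_def by (metis add_diff_cancel diff_add_cancel)
    then show ?thesis
      using inv[of 0 x0] unfolding supports_up_to_def g by simp
  qed
  then show ?thesis
    unfolding set_eq_iff core_subdiff_iff by (simp add: g)
qed

lemma top_dual_scale_add:
  assumes "l \<in> top_dual" "m \<in> top_dual"
  shows "(\<lambda>u. c * m u + l u) \<in> top_dual"
  using assms unfolding top_dual_def
  by (auto intro!: continuous_intros linearI simp: linear_add linear_scale algebra_simps)

text \<open>The error \<open>\<epsilon>\<close> for \<open>f\<close> becomes \<open>\<mu> * \<epsilon>\<close>, so slope \<open>M\<close> for the new function is slope \<open>M * \<mu>\<close> for \<open>f\<close>.\<close>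

lemma core_subdiff_affine_image_subset:
  assumes l: "l \<in> top_dual" and \<mu>: "\<mu> > 0" and m: "m \<in> core_subdiff d f x"
  shows "(\<lambda>u. \<mu> * m u + l u) \<in> core_subdiff d (\<lambda>u. ereal \<mu> * f u + ereal (l u)) x"
proof -
  have lin: "linear l"
    using l by (simp add: top_dual_def)
  obtain a where a: "f x = ereal a"
    using core_subdiffD(2)[OF m] by auto
  show ?thesis
    unfolding core_subdiff_iff
  proof (intro conjI allI impI top_dual_scale_add l core_subdiffD(1)[OF m])
    fix M \<eta> :: real assume pos: "M > 0" "\<eta> > 0"
    obtain \<epsilon> where \<epsilon>: "0 < \<epsilon>" "\<epsilon> < \<eta> / \<mu>" and supp: "supports_up_to d f x m (M * \<mu> * \<epsilon>) \<epsilon>"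
      using core_subdiffD(3)[OF m, of "M * \<mu>" "\<eta> / \<mu>"] pos \<mu> by auto
    have "supports_up_to d (\<lambda>u. ereal \<mu> * f u + ereal (l u)) x (\<lambda>u. \<mu> * m u + l u)
        (M * (\<mu> * \<epsilon>)) (\<mu> * \<epsilon>)"
      unfolding supports_up_to_def
    proof (intro allI impI)
      fix u assume "d x u \<le> M * (\<mu> * \<epsilon>)"
      then have le: "f x + ereal (m (u - x)) \<le> f u + ereal \<epsilon>"
        using supp unfolding supports_up_to_def by (simp add: mult_ac)
      show "ereal \<mu> * f x + ereal (l x) + ereal (\<mu> * m (u - x) + l (u - x))
          \<le> ereal \<mu> * f u + ereal (l u) + ereal (\<mu> * \<epsilon>)"
      proof (cases "f u")
        case (real b)
        then have "\<mu> * (a + m (u - x)) \<le> \<mu> * (b + \<epsilon>)"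
          using le a \<mu> by simp
        then show ?thesis
          using real a by (simp add: linear_diff[OF lin] algebra_simps)
      qed (use le a \<mu> in auto)
    qed
    then show "\<exists>\<epsilon>. 0 < \<epsilon> \<and> \<epsilon> < \<eta> \<and> supports_up_to d (\<lambda>u. ereal \<mu> * f u + ereal (l u)) x
        (\<lambda>u. \<mu> * m u + l u) (M * \<epsilon>) \<epsilon>"
      using \<epsilon> \<mu> by (intro exI[of _ "\<mu> * \<epsilon>"]) (auto simp: field_simps)
  qed (simp add: a)
qed

lemma core_subdiff_affine:
  assumes l: "l \<in> top_dual" and \<mu>: "\<mu> > 0"
  shows "core_subdiff d (\<lambda>u. ereal \<mu> * f u + ereal (l u)) x =
    (\<lambda>m u. \<mu> * m u + l u) ` core_subdiff d f x" (is "core_subdiff d ?g x = ?T ` _")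
proof
  show "?T ` core_subdiff d f x \<subseteq> core_subdiff d ?g x"
    using core_subdiff_affine_image_subset[OF l \<mu>] by blast
  show "core_subdiff d ?g x \<subseteq> ?T ` core_subdiff d f x"
  proof
    fix k assume k: "k \<in> core_subdiff d ?g x"
    \<comment> \<open>\<open>f\<close> arises from \<open>?g\<close> by scaling with \<open>1 / \<mu>\<close> and adding \<open>l'\<close>.\<close>
    define l' where "l' = (\<lambda>u. - (1 / \<mu>) * l u + 0)"
    have "l' \<in> top_dual"
      unfolding l'_def using l by (intro top_dual_scale_add) (auto simp: top_dual_def intro: module_hom_zero)
    then have "(\<lambda>u. 1 / \<mu> * k u + l' u) \<in> core_subdiff d (\<lambda>u. ereal (1 / \<mu>) * ?g u + ereal (l' u)) x"
      using \<mu> k by (intro core_subdiff_affine_image_subset) auto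
    moreover have "ereal (1 / \<mu>) * ?g u + ereal (l' u) = f u" for u
      using \<mu> unfolding l'_def by (cases "f u") (auto simp: field_simps)
    ultimately have mem: "(\<lambda>u. 1 / \<mu> * k u + l' u) \<in> core_subdiff d f x"
      by simp
    have "k = ?T (\<lambda>u. 1 / \<mu> * k u + l' u)"
      using \<mu> unfolding l'_def by (auto simp: field_simps)
    then show "k \<in> ?T ` core_subdiff d f x"
      using mem by (rule image_eqI[where f = ?T])
  qed
qed

section \<open>Calculus of the core subdifferential\<close>

theorem theorem14:
  fixes d :: "'a::{real_vector, topological_ab_group_add} \<Rightarrow> 'a \<Rightarrow> real"
    and f g :: "'a \<Rightarrow> ereal"
    and h :: "'b::real_normed_vector \<Rightarrow> ereal"
  assumes scaleR_cont: "continuous_on UNIV (\<lambda>(c :: real, x :: 'a). c *\<^sub>R x)"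
    and d: "compatible_metric d"
  shows
    "(\<forall>x. fenchel_subdiff f x \<subseteq> core_subdiff d f x) \<and>
     (convex_ereal_fun h \<longrightarrow> (\<forall>x. core_subdiff dist h x = fenchel_subdiff h x)) \<and>
     (\<forall>x. local_minimum_point f x \<longrightarrow> (\<lambda>_. 0) \<in> core_subdiff d f x) \<and>
     (\<forall>x. core_subdiff d f x \<noteq> {} \<longrightarrow> lsc_at f x) \<and>
     (\<forall>x. (\<forall>\<^sub>F u in nhds x. g u = f u) \<longrightarrow> core_subdiff d g x = core_subdiff d f x) \<and>
     (\<forall>x. closed {\<phi> :: 'b \<Rightarrow>\<^sub>L real. blinfun_apply \<phi> \<in> core_subdiff dist h x}) \<and>
     (\<forall>x0. (\<forall>x y z. d (x + z) (y + z) = d x y) \<and> (\<forall>x. g x = f (x + x0)) \<longrightarrow>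
        core_subdiff d g 0 = core_subdiff d f x0) \<and>
     (\<forall>l \<in> top_dual. \<forall>\<mu>>0. \<forall>x.
        core_subdiff d (\<lambda>u. ereal \<mu> * f u + ereal (l u)) x =
        (\<lambda>m u. \<mu> * m u + l u) ` core_subdiff d f x)"
proof (intro conjI allI impI ballI)
  show "fenchel_subdiff f x \<subseteq> core_subdiff d f x" for x
    using d by (rule fenchel_subdiff_subset_core)
  show "core_subdiff dist h x = fenchel_subdiff h x" if "convex_ereal_fun h" for x
    using that by (rule core_subdiff_eq_fenchel_if_convex)
  show "(\<lambda>_. 0) \<in> core_subdiff d f x" if "local_minimum_point f x" for x
    using d that by (rule zero_in_core_of_local_minimum)
  show "lsc_at f x" if "core_subdiff d f x \<noteq> {}" for x
    using d that by (rule lsc_at_if_core_nonempty)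
  show "core_subdiff d g x = core_subdiff d f x" if "\<forall>\<^sub>F u in nhds x. g u = f u" for x
    using d that by (rule core_subdiff_cong_nhds)
  show "closed {\<phi> :: 'b \<Rightarrow>\<^sub>L real. blinfun_apply \<phi> \<in> core_subdiff dist h x}" for x
    by (rule closed_core_subdiff)
  show "core_subdiff d g 0 = core_subdiff d f x0"
    if "(\<forall>x y z. d (x + z) (y + z) = d x y) \<and> (\<forall>x. g x = f (x + x0))" for x0
    using that by (intro core_subdiff_translate) auto
  show "core_subdiff d (\<lambda>u. ereal \<mu> * f u + ereal (l u)) x =
      (\<lambda>m u. \<mu> * m u + l u) ` core_subdiff d f x" if "l \<in> top_dual" "\<mu> > 0" for l \<mu> x
    using that by (rule core_subdiff_affine)
qed

end
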